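(* Let $G_1,\ldots,G_n$ be nondeterministic automata, where $G_i$ has state set $Q_i$ and set of secret states $Q_i^S$, and consider the composed system $G_1\|\cdots\|G_n$ with interaction $\|_\lor$, i.e. with set of secret states $Q^S=Q\setminus(Q_1^{NS}\times\cdots\times Q_n^{NS})$ where $Q=Q_1\times\cdots\times Q_n$ and $Q_i^{NS}=Q_i\setminus Q_i^S$. Let $det(G_i)=\langle\Sigma_i,X^i_{obs},\to_i,X_i^\circ\rangle$ be the current-state estimator of $G_i$, $1\le i\le n$. Then $G_1\|\cdots\|G_n$ is current-state opaque if and only if, for every string $s$, $det(G_1)\|\cdots\|det(G_n)\stackrel{s}{\to}(X_1,\ldots,X_n)$ implies $X_i\not\subseteq Q_i^S$ for all $1\le i\le n$.
   Context: An automaton is $G=\langle\Sigma_\tau,Q,\to,Q^\circ\rangle$ with finite set $\Sigma$ of observable events, a special unobservable event $\tau\notin\Sigma$, $\Sigma_\tau=\Sigma\cup\{\tau\}$, finite state set $Q$, transition relation $\to\subseteq Q\times\Sigma_\tau\times Q$, initial states $Q^\circ$; it carries a set of secret states $Q^S\subseteq Q$. For $s\in\Sigma^*$, $p\stackrel{s}{\Rightarrow}q$ means there is $t\in\Sigma_\tau^*$ which becomes $s$ after deleting all $\tau$'s and $p\stackrel{t}{\to}q$; $L(G,q)=\{s\in\Sigma^*: q\stackrel{s}{\Rightarrow}q'\text{ for some }q'\}$. Synchronous composition: states are tuples, initial states products of initial states; an event shared by components (events in $\Sigma$ only; $\tau$ is never shared) is executed jointly by all components having it in their alphabet, other events (including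 $\tau$) are executed by a single component while the others stay put. Current-state opacity: $G$ is current-state opaque w.r.t. $Q^S$ iff for every $q^\circ\in Q^\circ$ and every $s\in L(G,q^\circ)$ with $q^\circ\stackrel{s}{\Rightarrow}Q^S$ there is $q'^\circ\in Q^\circ$ with $q'^\circ\stackrel{s}{\Rightarrow}Q\setminus Q^S$. Current-state estimator (observer): for $B\subseteq Q$, $UR(B)$ is the set of states reachable from $B$ by strings in $\{\tau\}^*$. $det(G)=\langle\Sigma,X_{obs},\to_{obs},X^\circ_{obs}\rangle$ is the deterministic automaton with initial state $X^\circ_{obs}=UR(Q^\circ)$ and transitions $X\stackrel{\sigma}{\to}_{obs}Y$ for $\sigma\in\Sigma$, where $Y=\bigcup\{UR(\{y\}): x\stackrel{\sigma}{\to}y,\ x\in X\}$ is nonempty; $X_{obs}\subseteq 2^Q$ consists of the states reachable from $X^\circ_{obs}$. Compositions of estimators are synchronous compositions of these deterministic automata.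
   Formalization: If some G_i has no initial state, the estimator det(G_i) is taken to have no initial state instead of the initial state ∅; with the literal UR(∅)=∅ the equivalence fails, since the system is vacuously opaque while ∅ ⊆ Q_i^S. *)

theory Defs
  imports Main "HOL-Library.FuncSet"
begin

text \<open>
  Labels have type \<^typ>\<open>'e option\<close>: \<^term>\<open>Some \<sigma>\<close> is the observable event \<open>\<sigma>\<close> and
  \<^term>\<open>None\<close> is the unobservable event \<open>\<tau>\<close>. The field \<open>alphabet\<close> is \<open>\<Sigma>\<close>, without \<open>\<tau>\<close>.
\<close>

record ('e, 'q) automaton =
  alphabet :: "'e set"
  states :: "'q set"
  transitions :: "('q \<times> 'e option \<times> 'q) set"
  initials :: "'q set"

definition wf_automaton :: "('e, 'q) automaton \<Rightarrow> bool" where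
  "wf_automaton G \<longleftrightarrow>
     finite (alphabet G) \<and> finite (states G) \<and>
     transitions G \<subseteq> states G \<times> insert None (Some ` alphabet G) \<times> states G \<and>
     initials G \<subseteq> states G"

primrec run :: "('e, 'q) automaton \<Rightarrow> 'q \<Rightarrow> 'e option list \<Rightarrow> 'q \<Rightarrow> bool" where
  "run G p [] q \<longleftrightarrow> p = q"
| "run G p (a # t) q \<longleftrightarrow> (\<exists>r. (p, a, r) \<in> transitions G \<and> run G r t q)"

definition observation :: "'e option list \<Rightarrow> 'e list" where
  "observation t = map the (filter (\<lambda>a. a \<noteq> None) t)"

definition weak_run :: "('e, 'q) automaton \<Rightarrow> 'q \<Rightarrow> 'e list \<Rightarrow> 'q \<Rightarrow> bool" where
  "weak_run G p s q \<longleftrightarrow> (\<exists>t. observation t = s \<and> run G p t q)"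

definition language :: "('e, 'q) automaton \<Rightarrow> 'q \<Rightarrow> 'e list set" where
  "language G q = {s \<in> lists (alphabet G). \<exists>q'. weak_run G q s q'}"

definition current_state_opaque :: "('e, 'q) automaton \<Rightarrow> 'q set \<Rightarrow> bool" where
  "current_state_opaque G S \<longleftrightarrow>
     (\<forall>p \<in> initials G. \<forall>s \<in> language G p.
        (\<exists>q \<in> S. weak_run G p s q) \<longrightarrow>
        (\<exists>p' \<in> initials G. \<exists>q' \<in> states G - S. weak_run G p' s q'))"

text \<open>
  The composition of \<open>G 1, \<dots>, G n\<close>; a tuple of states is an extensional function on \<open>{1..n}\<close>.
  An event that lies in a single alphabet is covered by the first set of transitions.
\<close>

definition sync :: "nat \<Rightarrow> (nat \<Rightarrow> ('e, 'q) automaton) \<Rightarrow> ('e, nat \<Rightarrow> 'q) automaton" where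
  "sync n G =
     \<lparr> alphabet = (\<Union>i\<in>{1..n}. alphabet (G i)),
       states = (\<Pi>\<^sub>E i\<in>{1..n}. states (G i)),
       transitions =
         {(x, Some \<sigma>, y) | x \<sigma> y.
            x \<in> (\<Pi>\<^sub>E i\<in>{1..n}. states (G i)) \<and> y \<in> (\<Pi>\<^sub>E i\<in>{1..n}. states (G i)) \<and>
            \<sigma> \<in> (\<Union>i\<in>{1..n}. alphabet (G i)) \<and>
            (\<forall>i\<in>{1..n}. if \<sigma> \<in> alphabet (G i) then (x i, Some \<sigma>, y i) \<in> transitions (G i)
                        else y i = x i)}
         \<union>
         {(x, None, y) | x y.
            x \<in> (\<Pi>\<^sub>E i\<in>{1..n}. states (G i)) \<and> y \<in> (\<Pi>\<^sub>E i\<in>{1..n}. states (G i)) \<and>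
            (\<exists>i\<in>{1..n}. (x i, None, y i) \<in> transitions (G i) \<and>
                        (\<forall>j\<in>{1..n} - {i}. y j = x j))},
       initials = (\<Pi>\<^sub>E i\<in>{1..n}. initials (G i)) \<rparr>"

definition secret_or ::
  "nat \<Rightarrow> (nat \<Rightarrow> ('e, 'q) automaton) \<Rightarrow> (nat \<Rightarrow> 'q set) \<Rightarrow> (nat \<Rightarrow> 'q) set" where
  "secret_or n G S =
     (\<Pi>\<^sub>E i\<in>{1..n}. states (G i)) - (\<Pi>\<^sub>E i\<in>{1..n}. states (G i) - S i)"

definition unobservable_reach :: "('e, 'q) automaton \<Rightarrow> 'q set \<Rightarrow> 'q set" where
  "unobservable_reach G B = {q. \<exists>p \<in> B. \<exists>t \<in> lists {None}. run G p t q}"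

definition obs_succ :: "('e, 'q) automaton \<Rightarrow> 'q set \<Rightarrow> 'e \<Rightarrow> 'q set" where
  "obs_succ G X \<sigma> =
     \<Union> {unobservable_reach G {y} | x y. x \<in> X \<and> (x, Some \<sigma>, y) \<in> transitions G}"

text \<open>
  The empty set is never an estimator state. For transitions this is the explicit nonemptiness
  condition; for the initial state it only matters when \<open>G\<close> has no initial state at all, in which
  case the estimator has none either (see \<open>initials_det\<close> below for the usual case).
\<close>

inductive_set obs_states :: "('e, 'q) automaton \<Rightarrow> 'q set set" for G where
  initial: "unobservable_reach G (initials G) \<noteq> {} \<Longrightarrow>
    unobservable_reach G (initials G) \<in> obs_states G"
| step: "X \<in> obs_states G \<Longrightarrow> \<sigma> \<in> alphabet G \<Longrightarrow> obs_succ G X \<sigma> \<noteq> {} \<Longrightarrow>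
    obs_succ G X \<sigma> \<in> obs_states G"

definition det :: "('e, 'q) automaton \<Rightarrow> ('e, 'q set) automaton" where
  "det G =
     \<lparr> alphabet = alphabet G,
       states = obs_states G,
       transitions = {(X, Some \<sigma>, Y) | X \<sigma> Y.
         X \<in> obs_states G \<and> \<sigma> \<in> alphabet G \<and> Y = obs_succ G X \<sigma> \<and> Y \<noteq> {}},
       initials = {unobservable_reach G (initials G)} - {{}} \<rparr>"

lemma subset_unobservable_reach: "B \<subseteq> unobservable_reach G B"
proof
  fix q assume "q \<in> B"
  moreover have "run G q [] q" by simp
  ultimately show "q \<in> unobservable_reach G B"
    unfolding unobservable_reach_def by blast
qed

lemma initials_det:
  assumes "initials G \<noteq> {}"
  shows "initials (det G) = {unobservable_reach G (initials G)}"
  using assms subset_unobservable_reach[of "initials G" G] by (auto simp: det_def)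

lemma run_in_states:
  assumes "wf_automaton G" "p \<in> states G" "run G p t q"
  shows "q \<in> states G"
  using assms(2,3)
proof (induction t arbitrary: p)
  case (Cons a t)
  then show ?case using assms(1) unfolding wf_automaton_def by fastforce
qed simp

lemma obs_states_subset:
  assumes "wf_automaton G"
  shows "obs_states G \<subseteq> Pow (states G)"
proof
  fix X assume "X \<in> obs_states G"
  then show "X \<in> Pow (states G)"
  proof cases
    case initial
    then show ?thesis using assms run_in_states[OF assms]
      unfolding unobservable_reach_def wf_automaton_def by blast
  next
    case (step Z \<sigma>)
    have "y \<in> states G" if "(x, Some \<sigma>, y) \<in> transitions G" for x y
      using that assms unfolding wf_automaton_def by blast
    then show ?thesis using step run_in_states[OF assms]
      unfolding obs_succ_def unobservable_reach_def by blast
  qed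
qed

lemma wf_det:
  assumes "wf_automaton G"
  shows "wf_automaton (det G)"
proof -
  have "finite (obs_states G)"
    using obs_states_subset[OF assms] assms
    by (meson finite_Pow_iff finite_subset wf_automaton_def)
  then show ?thesis using assms
    by (auto simp: wf_automaton_def det_def intro: obs_states.intros)
qed

lemma wf_sync:
  assumes "\<And>i. i \<in> {1..n} \<Longrightarrow> wf_automaton (G i)"
  shows "wf_automaton (sync n G)"
proof -
  have "finite (\<Pi>\<^sub>E i\<in>{1..n}. states (G i))"
    using assms by (intro finite_PiE) (auto simp: wf_automaton_def)
  moreover have "(\<Pi>\<^sub>E i\<in>{1..n}. initials (G i)) \<subseteq> (\<Pi>\<^sub>E i\<in>{1..n}. states (G i))"
    using assms by (intro PiE_mono) (auto simp: wf_automaton_def)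
  moreover have "finite (\<Union>i\<in>{1..n}. alphabet (G i))"
    using assms by (auto simp: wf_automaton_def)
  ultimately show ?thesis unfolding wf_automaton_def sync_def by auto
qed

end

theory Submission imports Defs begin

text \<open>
  A run of a composition exists exactly when each component can run over the projection of the
  observed string to its own alphabet. Hence the estimate of the composition after \<open>s\<close> is the
  product of the estimates of the components after the projections of \<open>s\<close>. The same fact, applied
  to the estimators, shows that their composition reaches exactly the tuple of these estimates,
  provided that none of them is empty. A product of sets meets the product of the nonsecret sets iff
  every factor does.
\<close>

subsection \<open>Weak runs\<close>

lemma weak_run_refl: "weak_run G p [] p"
  unfolding weak_run_def by (rule exI[of _ "[]"]) (simp add: observation_def)

lemma weak_run_tau:
  assumes "(p, None, r) \<in> transitions G" "weak_run G r s q"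
  shows "weak_run G p s q"
proof -
  obtain t where "observation t = s" "run G r t q"
    using assms(2) unfolding weak_run_def by blast
  then have "observation (None # t) = s" "run G p (None # t) q"
    using assms(1) by (auto simp: observation_def)
  then show ?thesis unfolding weak_run_def by blast
qed

lemma weak_run_event:
  assumes "(p, Some \<sigma>, r) \<in> transitions G" "weak_run G r s q"
  shows "weak_run G p (\<sigma> # s) q"
proof -
  obtain t where "observation t = s" "run G r t q"
    using assms(2) unfolding weak_run_def by blast
  then have "observation (Some \<sigma> # t) = \<sigma> # s" "run G p (Some \<sigma> # t) q"
    using assms(1) by (auto simp: observation_def)
  then show ?thesis unfolding weak_run_def by blast
qed

lemma weak_run_induct [consumes 1, case_names refl tau event]:
  assumes "weak_run G p s q"
    and refl: "\<And>p. P p [] p"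
    and tau: "\<And>p r s q. (p, None, r) \<in> transitions G \<Longrightarrow> weak_run G r s q \<Longrightarrow> P r s q \<Longrightarrow> P p s q"
    and event: "\<And>p \<sigma> r s q.
      (p, Some \<sigma>, r) \<in> transitions G \<Longrightarrow> weak_run G r s q \<Longrightarrow> P r s q \<Longrightarrow> P p (\<sigma> # s) q"
  shows "P p s q"
proof -
  obtain t where "observation t = s" "run G p t q"
    using assms(1) unfolding weak_run_def by blast
  then show ?thesis
  proof (induction t arbitrary: p s)
    case Nil
    then show ?case using refl by (simp add: observation_def)
  next
    case (Cons a t)
    then obtain r where r: "(p, a, r) \<in> transitions G" "run G r t q" by auto
    have weak: "weak_run G r (observation t) q" unfolding weak_run_def using r(2) by blast
    have IH: "P r (observation t) q" using Cons.IH r(2) by blast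
    show ?case
    proof (cases a)
      case None
      then show ?thesis using tau r(1) weak IH Cons.prems(1) by (simp add: observation_def)
    next
      case (Some \<sigma>)
      then show ?thesis using event r(1) weak IH Cons.prems(1) by (auto simp: observation_def)
    qed
  qed
qed

lemma weak_run_trans:
  assumes "weak_run G p s r" "weak_run G r s' q"
  shows "weak_run G p (s @ s') q"
  using assms by (induction rule: weak_run_induct) (auto intro: weak_run_tau weak_run_event)

lemma weak_run_snoc_iff:
  "weak_run G p (s @ [\<sigma>]) q \<longleftrightarrow>
    (\<exists>r r'. weak_run G p s r \<and> (r, Some \<sigma>, r') \<in> transitions G \<and> weak_run G r' [] q)"
proof
  assume "weak_run G p (s @ [\<sigma>]) q"
  then show "\<exists>r r'. weak_run G p s r \<and> (r, Some \<sigma>, r') \<in> transitions G \<and> weak_run G r' [] q"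
  proof (induction p "s @ [\<sigma>]" q arbitrary: s rule: weak_run_induct)
    case (tau p r q)
    then show ?case using weak_run_tau by meson
  next
    case (event p \<rho> r w q)
    show ?case
    proof (cases s)
      case Nil
      then show ?thesis using event by (auto intro: weak_run_refl)
    next
      case (Cons \<rho>' s')
      then have "\<rho>' = \<rho>" "w = s' @ [\<sigma>]" using event.hyps(4) by auto
      then show ?thesis using event.hyps(1,3) weak_run_event unfolding Cons by metis
    qed
  qed simp
next
  assume "\<exists>r r'. weak_run G p s r \<and> (r, Some \<sigma>, r') \<in> transitions G \<and> weak_run G r' [] q"
  then show "weak_run G p (s @ [\<sigma>]) q" using weak_run_trans weak_run_event by metis
qed

lemma weak_run_in_states:
  assumes "wf_automaton G" "p \<in> states G" "weak_run G p s q"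
  shows "q \<in> states G"
  using assms run_in_states unfolding weak_run_def by metis

lemma weak_run_in_lists_alphabet:
  assumes "wf_automaton G" "weak_run G p s q"
  shows "s \<in> lists (alphabet G)"
  using assms(2,1) by (induction rule: weak_run_induct) (auto simp: wf_automaton_def)

definition tau_free :: "('e, 'q) automaton \<Rightarrow> bool" where
  "tau_free G \<longleftrightarrow> (\<forall>p q. (p, None, q) \<notin> transitions G)"

lemma weak_run_tau_free_iff:
  assumes "tau_free G"
  shows "weak_run G p s q \<longleftrightarrow> run G p (map Some s) q"
proof
  assume "weak_run G p s q"
  then show "run G p (map Some s) q"
    using assms by (induction rule: weak_run_induct) (auto simp: tau_free_def)
next
  assume "run G p (map Some s) q"
  moreover have "observation (map Some s) = s" by (induction s) (auto simp: observation_def)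
  ultimately show "weak_run G p s q" unfolding weak_run_def by blast
qed

subsection \<open>Runs of a synchronous composition\<close>

abbreviation natural_projection :: "'e set \<Rightarrow> 'e list \<Rightarrow> 'e list" where
  "natural_projection A \<equiv> filter (\<lambda>\<sigma>. \<sigma> \<in> A)"

lemma sync_simps:
  "alphabet (sync n G) = (\<Union>i\<in>{1..n}. alphabet (G i))"
  "states (sync n G) = (\<Pi>\<^sub>E i\<in>{1..n}. states (G i))"
  "initials (sync n G) = (\<Pi>\<^sub>E i\<in>{1..n}. initials (G i))"
  by (simp_all add: sync_def)

lemma sync_Some_iff:
  "(x, Some \<sigma>, y) \<in> transitions (sync n G) \<longleftrightarrow>
    x \<in> states (sync n G) \<and> y \<in> states (sync n G) \<and> \<sigma> \<in> alphabet (sync n G) \<and>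
    (\<forall>i\<in>{1..n}. if \<sigma> \<in> alphabet (G i) then (x i, Some \<sigma>, y i) \<in> transitions (G i)
       else y i = x i)"
  by (simp add: sync_def)

lemma sync_None_iff:
  "(x, None, y) \<in> transitions (sync n G) \<longleftrightarrow>
    x \<in> states (sync n G) \<and> y \<in> states (sync n G) \<and>
    (\<exists>i\<in>{1..n}. (x i, None, y i) \<in> transitions (G i) \<and> (\<forall>j\<in>{1..n} - {i}. y j = x j))"
  by (simp add: sync_def)

lemma tau_free_sync:
  assumes "\<And>i. i \<in> {1..n} \<Longrightarrow> tau_free (G i)"
  shows "tau_free (sync n G)"
  using assms unfolding tau_free_def sync_None_iff by blast

lemma weak_run_sync_component:
  assumes "weak_run (sync n G) x s y" "i \<in> {1..n}"
  shows "weak_run (G i) (x i) (natural_projection (alphabet (G i)) s) (y i)"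
  using assms(1)
proof (induction rule: weak_run_induct)
  case refl
  show ?case by (simp add: weak_run_refl)
next
  case (tau x z s y)
  then obtain k where "(x k, None, z k) \<in> transitions (G k)" "\<forall>j\<in>{1..n} - {k}. z j = x j"
    unfolding sync_None_iff by blast
  then show ?case using tau.IH assms(2) by (cases "i = k") (auto intro: weak_run_tau)
next
  case (event x \<sigma> z s y)
  then have "if \<sigma> \<in> alphabet (G i) then (x i, Some \<sigma>, z i) \<in> transitions (G i) else z i = x i"
    using assms(2) unfolding sync_Some_iff by blast
  then show ?case using event.IH by (auto intro: weak_run_event split: if_splits)
qed

lemma weak_run_Nil_sync_fun_upd:
  assumes "wf_automaton (G i)" "i \<in> {1..n}" "x \<in> states (sync n G)"
    and "weak_run (G i) (x i) [] q"
  shows "weak_run (sync n G) x [] (x(i := q))"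
  using assms(4,3)
proof (induction "x i" "[] :: 'a list" q arbitrary: x rule: weak_run_induct)
  case refl
  show ?case by (simp add: weak_run_refl)
next
  case (tau r q)
  have "r \<in> states (G i)" using tau.hyps(1) assms(1) unfolding wf_automaton_def by blast
  then have upd: "x(i := r) \<in> states (sync n G)"
    using tau.prems assms(2) by (auto simp: sync_simps PiE_iff extensional_def)
  then have "(x, None, x(i := r)) \<in> transitions (sync n G)"
    using tau.hyps(1) tau.prems assms(2) unfolding sync_None_iff by auto
  moreover have "weak_run (sync n G) (x(i := r)) [] (x(i := q))"
    using tau.hyps(3)[of "x(i := r)"] upd by simp
  ultimately show ?case by (rule weak_run_tau)
qed

lemma weak_run_Nil_sync:
  assumes wf: "\<And>i. i \<in> {1..n} \<Longrightarrow> wf_automaton (G i)"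
    and "x \<in> states (sync n G)" "y \<in> states (sync n G)"
    and "\<And>i. i \<in> {1..n} \<Longrightarrow> weak_run (G i) (x i) [] (y i)"
  shows "weak_run (sync n G) x [] y"
proof -
  have "weak_run (sync n G) z [] y"
    if "finite J" "J \<subseteq> {1..n}" "z \<in> states (sync n G)" "\<forall>i\<in>{1..n} - J. z i = y i"
      "\<forall>i\<in>J. weak_run (G i) (z i) [] (y i)" for z J
    using that
  proof (induction J arbitrary: z rule: finite_induct)
    case empty
    then have "z = y" using assms(3) by (auto simp: sync_simps intro: PiE_ext)
    then show ?case by (simp add: weak_run_refl)
  next
    case (insert i J)
    then have i: "i \<in> {1..n}" by blast
    let ?z' = "z(i := y i)"
    have "weak_run (sync n G) z [] ?z'"
      using insert.prems i wf by (intro weak_run_Nil_sync_fun_upd) auto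
    moreover have "weak_run (sync n G) ?z' [] y"
    proof (rule insert.IH)
      show "?z' \<in> states (sync n G)"
        using insert.prems i assms(3) by (auto simp: sync_simps PiE_iff extensional_def)
      show "\<forall>j\<in>{1..n} - J. ?z' j = y j" using insert.prems by auto
      show "\<forall>j\<in>J. weak_run (G j) (?z' j) [] (y j)" using insert.prems insert.hyps by auto
    qed (use insert.prems in blast)
    ultimately show ?case using weak_run_trans[of _ z "[]" _ "[]"] by auto
  qed
  from this[of "{1..n}"] show ?thesis using assms by simp
qed

lemma weak_run_sync:
  assumes wf: "\<And>i. i \<in> {1..n} \<Longrightarrow> wf_automaton (G i)"
    and "s \<in> lists (alphabet (sync n G))"
    and x: "x \<in> states (sync n G)"
    and "y \<in> states (sync n G)"
    and "\<And>i. i \<in> {1..n} \<Longrightarrow>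
      weak_run (G i) (x i) (natural_projection (alphabet (G i)) s) (y i)"
  shows "weak_run (sync n G) x s y"
  using assms(2,4,5)
proof (induction s arbitrary: y rule: rev_induct)
  case Nil
  then show ?case using wf x by (intro weak_run_Nil_sync) auto
next
  case (snoc \<sigma> s)
  let ?step = "\<lambda>i r r'.
    if \<sigma> \<in> alphabet (G i) then (r, Some \<sigma>, r') \<in> transitions (G i) else r' = r"
  have "\<exists>r r'. weak_run (G i) (x i) (natural_projection (alphabet (G i)) s) r \<and>
      ?step i r r' \<and> weak_run (G i) r' [] (y i)" if "i \<in> {1..n}" for i
    using snoc.prems(3)[OF that]
    by (cases "\<sigma> \<in> alphabet (G i)") (auto simp: weak_run_snoc_iff intro: weak_run_refl)
  then obtain r r' where
    before: "\<And>i. i \<in> {1..n} \<Longrightarrow>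
      weak_run (G i) (x i) (natural_projection (alphabet (G i)) s) (r i)" and
    step: "\<And>i. i \<in> {1..n} \<Longrightarrow> ?step i (r i) (r' i)" and
    after: "\<And>i. i \<in> {1..n} \<Longrightarrow> weak_run (G i) (r' i) [] (y i)"
    by metis
  let ?r = "restrict r {1..n}" and ?r' = "restrict r' {1..n}"
  have r_states: "r i \<in> states (G i)" if "i \<in> {1..n}" for i
    using weak_run_in_states[OF wf[OF that] _ before[OF that]] x that
    by (auto simp: sync_simps PiE_iff)
  have "r' i \<in> states (G i)" if "i \<in> {1..n}" for i
    using step[OF that] r_states[OF that] wf[OF that] unfolding wf_automaton_def
    by (auto split: if_splits)
  then have r'_states: "?r' \<in> states (sync n G)" by (simp add: sync_simps)
  have "weak_run (sync n G) x s ?r"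
    using snoc.prems(1) before r_states by (intro snoc.IH) (auto simp: sync_simps)
  moreover have "(?r, Some \<sigma>, ?r') \<in> transitions (sync n G)"
    using snoc.prems(1) step r_states r'_states by (simp add: sync_Some_iff sync_simps(2))
  moreover have "weak_run (sync n G) ?r' [] y"
    using wf r'_states snoc.prems(2) after by (intro weak_run_Nil_sync) auto
  ultimately show ?case unfolding weak_run_snoc_iff by blast
qed

subsection \<open>State estimates\<close>

definition estimate :: "('e, 'q) automaton \<Rightarrow> 'e list \<Rightarrow> 'q set" where
  "estimate G s = {q. \<exists>p\<in>initials G. weak_run G p s q}"

lemma estimate_subset_states:
  assumes "wf_automaton G"
  shows "estimate G s \<subseteq> states G"
  using assms weak_run_in_states[OF assms] unfolding estimate_def wf_automaton_def by blast

lemma estimate_nonempty_imp_in_lists_alphabet: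
  assumes "wf_automaton G" "estimate G s \<noteq> {}"
  shows "s \<in> lists (alphabet G)"
  using assms(2) weak_run_in_lists_alphabet[OF assms(1)] unfolding estimate_def by blast

lemma current_state_opaque_iff_estimate:
  assumes "wf_automaton G"
  shows "current_state_opaque G S \<longleftrightarrow> (\<forall>s. estimate G s \<noteq> {} \<longrightarrow> \<not> estimate G s \<subseteq> S)"
proof -
  have "current_state_opaque G S \<longleftrightarrow>
      (\<forall>s. estimate G s \<inter> S \<noteq> {} \<longrightarrow> estimate G s \<inter> (states G - S) \<noteq> {})"
    using weak_run_in_lists_alphabet[OF assms]
    unfolding current_state_opaque_def language_def estimate_def by blast
  also have "\<dots> \<longleftrightarrow> (\<forall>s. estimate G s \<noteq> {} \<longrightarrow> \<not> estimate G s \<subseteq> S)"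
    using estimate_subset_states[OF assms] by blast
  finally show ?thesis .
qed

lemma estimate_sync:
  assumes wf: "\<And>i. i \<in> {1..n} \<Longrightarrow> wf_automaton (G i)"
    and s: "s \<in> lists (alphabet (sync n G))"
  shows "estimate (sync n G) s =
    (\<Pi>\<^sub>E i\<in>{1..n}. estimate (G i) (natural_projection (alphabet (G i)) s))" (is "_ = ?R")
proof (intro equalityI subsetI)
  fix y assume y: "y \<in> estimate (sync n G) s"
  then obtain x where x: "x \<in> (\<Pi>\<^sub>E i\<in>{1..n}. initials (G i))" "weak_run (sync n G) x s y"
    unfolding estimate_def sync_simps by blast
  have "y i \<in> estimate (G i) (natural_projection (alphabet (G i)) s)" if "i \<in> {1..n}" for i
    using PiE_mem[OF x(1) that] weak_run_sync_component[OF x(2) that]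
    unfolding estimate_def by blast
  moreover have "y \<in> (\<Pi>\<^sub>E i\<in>{1..n}. states (G i))"
    using y estimate_subset_states[OF wf_sync[of n G, OF wf]] unfolding sync_simps by blast
  ultimately show "y \<in> ?R" unfolding PiE_iff by blast
next
  fix y assume y: "y \<in> ?R"
  then have "\<forall>i\<in>{1..n}. \<exists>p. p \<in> initials (G i) \<and>
      weak_run (G i) p (natural_projection (alphabet (G i)) s) (y i)"
    by (auto simp: estimate_def PiE_iff)
  then obtain x where x: "\<And>i. i \<in> {1..n} \<Longrightarrow> x i \<in> initials (G i)"
    "\<And>i. i \<in> {1..n} \<Longrightarrow> weak_run (G i) (x i) (natural_projection (alphabet (G i)) s) (y i)"
    unfolding bchoice_iff by blast
  let ?x = "restrict x {1..n}"
  have init: "?x \<in> initials (sync n G)" using x(1) by (simp add: sync_simps)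
  then have "?x \<in> states (sync n G)"
    using wf_sync[of n G, OF wf] unfolding wf_automaton_def by blast
  moreover have "y \<in> states (sync n G)"
    unfolding sync_simps by (rule subsetD[OF PiE_mono y]) (rule estimate_subset_states[OF wf])
  ultimately have "weak_run (sync n G) ?x s y"
    using wf s x(2) by (intro weak_run_sync) auto
  then show "y \<in> estimate (sync n G) s" using init unfolding estimate_def by blast
qed

lemma PiE_subset_secret_or_iff:
  assumes "\<And>i. i \<in> {1..n} \<Longrightarrow> B i \<subseteq> states (G i)"
  shows "(\<Pi>\<^sub>E i\<in>{1..n}. B i) \<subseteq> secret_or n G S \<longleftrightarrow> (\<exists>i\<in>{1..n}. B i \<subseteq> S i)"
proof -
  have "(\<Pi>\<^sub>E i\<in>{1..n}. B i) \<subseteq> (\<Pi>\<^sub>E i\<in>{1..n}. states (G i))"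
    using assms by (rule PiE_mono)
  then have "(\<Pi>\<^sub>E i\<in>{1..n}. B i) \<subseteq> secret_or n G S \<longleftrightarrow>
      (\<Pi>\<^sub>E i\<in>{1..n}. B i \<inter> (states (G i) - S i)) = {}"
    unfolding secret_or_def PiE_Int[symmetric] by blast
  also have "\<dots> \<longleftrightarrow> (\<exists>i\<in>{1..n}. B i \<subseteq> S i)"
    unfolding PiE_eq_empty_iff using assms by blast
  finally show ?thesis .
qed

lemma estimate_sync_subset_secret_or_iff:
  assumes wf: "\<And>i. i \<in> {1..n} \<Longrightarrow> wf_automaton (G i)"
    and "estimate (sync n G) s \<noteq> {}"
  shows "estimate (sync n G) s \<subseteq> secret_or n G S \<longleftrightarrow>
    (\<exists>i\<in>{1..n}. estimate (G i) (natural_projection (alphabet (G i)) s) \<subseteq> S i)"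
proof -
  have "s \<in> lists (alphabet (sync n G))"
    using wf_sync[of n G, OF wf] assms(2) by (rule estimate_nonempty_imp_in_lists_alphabet)
  then have "estimate (sync n G) s =
      (\<Pi>\<^sub>E i\<in>{1..n}. estimate (G i) (natural_projection (alphabet (G i)) s))"
    using wf by (intro estimate_sync)
  then show ?thesis
    using PiE_subset_secret_or_iff[of n _ G S, OF estimate_subset_states[OF wf]] by simp
qed

subsection \<open>The estimator\<close>

lemma observation_eq_Nil_iff: "observation t = [] \<longleftrightarrow> t \<in> lists {None}"
  by (induction t) (auto simp: observation_def)

lemma unobservable_reach_eq_weak_run:
  "unobservable_reach G B = {q. \<exists>p\<in>B. weak_run G p [] q}"
  by (simp add: unobservable_reach_def weak_run_def observation_eq_Nil_iff Bex_def)

lemma obs_succ_eq_weak_run: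
  "obs_succ G X \<sigma> =
    {q. \<exists>x\<in>X. \<exists>y. (x, Some \<sigma>, y) \<in> transitions G \<and> weak_run G y [] q}"
  by (auto simp: obs_succ_def unobservable_reach_eq_weak_run)

lemma estimate_Nil: "estimate G [] = unobservable_reach G (initials G)"
  unfolding estimate_def unobservable_reach_eq_weak_run ..

lemma estimate_snoc: "estimate G (s @ [\<sigma>]) = obs_succ G (estimate G s) \<sigma>"
  by (auto simp: estimate_def obs_succ_eq_weak_run weak_run_snoc_iff)

lemma estimate_snoc_nonempty_imp:
  assumes "wf_automaton G" "estimate G (s @ [\<sigma>]) \<noteq> {}"
  shows "estimate G s \<noteq> {} \<and> \<sigma> \<in> alphabet G"
  using assms by (auto simp: estimate_snoc obs_succ_eq_weak_run wf_automaton_def)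

lemma estimate_in_obs_states:
  assumes "wf_automaton G" "estimate G s \<noteq> {}"
  shows "estimate G s \<in> obs_states G"
  using assms(2)
proof (induction s rule: rev_induct)
  case Nil
  then show ?case unfolding estimate_Nil by (rule obs_states.initial)
next
  case (snoc \<sigma> s)
  then show ?case
    using estimate_snoc_nonempty_imp[OF assms(1) snoc.prems]
    unfolding estimate_snoc by (intro obs_states.step) simp_all
qed

lemma det_simps:
  "alphabet (det G) = alphabet G"
  "initials (det G) = {unobservable_reach G (initials G)} - {{}}"
  by (simp_all add: det_def)

lemma det_Some_iff:
  "(X, Some \<sigma>, Y) \<in> transitions (det G) \<longleftrightarrow>
    X \<in> obs_states G \<and> \<sigma> \<in> alphabet G \<and> Y = obs_succ G X \<sigma> \<and> Y \<noteq> {}"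
  by (auto simp: det_def)

lemma tau_free_det: "tau_free (det G)"
  by (simp add: tau_free_def det_def)

lemma unobservable_reach_tau_free:
  assumes "tau_free G"
  shows "unobservable_reach G B = B"
  by (simp add: unobservable_reach_eq_weak_run weak_run_tau_free_iff[OF assms])

lemma estimate_det:
  assumes "wf_automaton G"
  shows "estimate (det G) s = {estimate G s} - {{}}"
proof (induction s rule: rev_induct)
  case Nil
  show ?case
    by (simp add: estimate_Nil det_simps unobservable_reach_tau_free[OF tau_free_det])
next
  case (snoc \<sigma> s)
  have "estimate (det G) (s @ [\<sigma>]) =
      {Y. \<exists>X\<in>estimate (det G) s. (X, Some \<sigma>, Y) \<in> transitions (det G)}"
    by (auto simp: estimate_snoc obs_succ_eq_weak_run weak_run_tau_free_iff[OF tau_free_det])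
  also have "\<dots> = {estimate G (s @ [\<sigma>])} - {{}}"
    using estimate_snoc_nonempty_imp[OF assms, of s \<sigma>] estimate_in_obs_states[OF assms, of s]
    unfolding snoc.IH det_Some_iff estimate_snoc by blast
  finally show ?case .
qed

lemma PiE_singleton_minus_empty:
  "(\<Pi>\<^sub>E i\<in>I. {f i} - {{}}) = (if \<exists>i\<in>I. f i = {} then {} else {restrict f I})"
proof (cases "\<exists>i\<in>I. f i = {}")
  case False
  then have "(\<Pi>\<^sub>E i\<in>I. {f i} - {{}}) = (\<Pi>\<^sub>E i\<in>I. {restrict f I i})"
    by (intro PiE_cong) auto
  also have "\<dots> = {restrict f I}" by (rule PiE_singleton) (rule restrict_extensional)
  finally show ?thesis using False by simp
qed (auto simp: PiE_eq_empty_iff)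

lemma estimate_sync_det:
  assumes wf: "\<And>i. i \<in> {1..n} \<Longrightarrow> wf_automaton (G i)"
  shows "estimate (sync n (\<lambda>i. det (G i))) s =
    (if estimate (sync n G) s = {} then {}
     else {\<lambda>i\<in>{1..n}. estimate (G i) (natural_projection (alphabet (G i)) s)})"
proof (cases "s \<in> lists (alphabet (sync n G))")
  case True
  let ?E = "\<lambda>i. estimate (G i) (natural_projection (alphabet (G i)) s)"
  have "estimate (sync n (\<lambda>i. det (G i))) s = (\<Pi>\<^sub>E i\<in>{1..n}. {?E i} - {{}})"
    using True wf by (subst estimate_sync)
      (auto simp: wf_det estimate_det det_simps sync_simps intro!: PiE_cong)
  also have "\<dots> = (if \<exists>i\<in>{1..n}. ?E i = {} then {} else {restrict ?E {1..n}})"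
    by (rule PiE_singleton_minus_empty)
  finally show ?thesis using estimate_sync[of n G s, OF wf True] by (auto simp: PiE_eq_empty_iff)
next
  case False
  have "wf_automaton (sync n (\<lambda>i. det (G i)))" using wf by (intro wf_sync wf_det)
  then have "estimate (sync n (\<lambda>i. det (G i))) s = {}"
    using False estimate_nonempty_imp_in_lists_alphabet by (fastforce simp: sync_simps det_simps)
  moreover have "estimate (sync n G) s = {}"
    using False estimate_nonempty_imp_in_lists_alphabet[OF wf_sync[of n G, OF wf]] by blast
  ultimately show ?thesis by simp
qed

theorem theorem2:
  fixes n :: nat
    and G :: "nat \<Rightarrow> ('e, 'q) automaton"
    and S :: "nat \<Rightarrow> 'q set"
  assumes "\<And>i. i \<in> {1..n} \<Longrightarrow> wf_automaton (G i)"
    and "\<And>i. i \<in> {1..n} \<Longrightarrow> S i \<subseteq> states (G i)"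
  shows "current_state_opaque (sync n G) (secret_or n G S) \<longleftrightarrow>
    (\<forall>s X. (\<exists>X0 \<in> initials (sync n (\<lambda>i. det (G i))).
              run (sync n (\<lambda>i. det (G i))) X0 (map Some s) X) \<longrightarrow>
           (\<forall>i\<in>{1..n}. \<not> X i \<subseteq> S i))"
proof -
  have "current_state_opaque (sync n G) (secret_or n G S) \<longleftrightarrow>
      (\<forall>s. estimate (sync n G) s \<noteq> {} \<longrightarrow> \<not> estimate (sync n G) s \<subseteq> secret_or n G S)"
    by (intro current_state_opaque_iff_estimate wf_sync assms(1))
  also have "\<dots> \<longleftrightarrow> (\<forall>s. \<forall>X\<in>estimate (sync n (\<lambda>i. det (G i))) s. \<forall>i\<in>{1..n}. \<not> X i \<subseteq> S i)"
  proof (rule all_cong1)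
    show "(estimate (sync n G) s \<noteq> {} \<longrightarrow> \<not> estimate (sync n G) s \<subseteq> secret_or n G S) \<longleftrightarrow>
        (\<forall>X\<in>estimate (sync n (\<lambda>i. det (G i))) s. \<forall>i\<in>{1..n}. \<not> X i \<subseteq> S i)" for s
      using estimate_sync_subset_secret_or_iff[of n G s S, OF assms(1)]
        estimate_sync_det[of n G s, OF assms(1)] by (auto split: if_splits)
  qed
  also have "\<dots> \<longleftrightarrow> (\<forall>s X. (\<exists>X0 \<in> initials (sync n (\<lambda>i. det (G i))).
              run (sync n (\<lambda>i. det (G i))) X0 (map Some s) X) \<longrightarrow>
           (\<forall>i\<in>{1..n}. \<not> X i \<subseteq> S i))"
    by (simp add: estimate_def weak_run_tau_free_iff tau_free_sync tau_free_det)
  finally show ?thesis .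
qed

end
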